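(* Let $\bm Z$ be the Gram matrix of an equiangular tight frame of $28$ vectors in $\mathbb{R}^7$, and let $N\ge 28$. Then for every $\bm X \in \mathscr{E}_4^N$ and every injective map $\pi:[28]\to[N]$, $$\sum_{1\le i<j\le 28} \mathrm{sgn}(Z_{ij})\, X_{\pi(i)\pi(j)} \le 112.$$ Moreover, this inequality cannot be obtained as a nonnegative linear combination of the triangle inequalities $-s_is_jX_{ij} - s_js_kX_{jk} - s_is_kX_{ik} \le 1$ ($i,j,k$ distinct, $\bm s\in\{\pm1\}^N$).
   Context: Unit vectors $\bm v_1,\dots,\bm v_N\in\mathbb{R}^r$ form an equiangular tight frame (ETF) if $\sum_i \bm v_i\bm v_i^\top = \frac{N}{r}\bm I_r$ and there is $\alpha\in[0,1]$ with $|\langle\bm v_i,\bm v_j\rangle| = \alpha$ for all $i\neq j$. A degree 4 pseudomoment matrix is a matrix $\bm Y \in \mathbb{R}^{N^2\times N^2}$, rows and columns indexed by pairs $(ij)\in[N]^2$ (lexicographically ordered), such that: (1) $\bm Y\succeq 0$; (2) $Y_{(ij)(kk)}$ does not depend on $k$; (3) $Y_{(ii)(ii)} = 1$ for all $i$; (4) $Y_{(ij)(k\ell)}$ is invariant under all permutations of the four indices $i,j,k,\ell$. Such $\bm Y$ extends $\bm X\in\mathbb{R}^{N\times N}_{\mathrm{sym}}$ if $Y_{(1i)(1j)} = X_{ij}$ for all $i,j$. $\mathscr{E}_4^N$ is the set of symmetric $\bm X \in \mathbb{R}^{N\times N}$ that are extended by some degree 4 pseudomoment matrix. *)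

theory Defs
  imports "HOL-Analysis.Analysis" "HOL-Combinatorics.Permutations"
begin

text \<open>Vectors are indexed by 0..M-1 (paper: 1..M).\<close>

definition is_ETF :: "nat \<Rightarrow> (nat \<Rightarrow> real^'r) \<Rightarrow> bool" where
  "is_ETF M v \<longleftrightarrow>
     (\<forall>i<M. norm (v i) = 1) \<and>
     (\<forall>a b. (\<Sum>i<M. v i $ a * v i $ b) = (if a = b then real M / real CARD('r) else 0)) \<and>
     (\<exists>\<alpha>::real. 0 \<le> \<alpha> \<and> \<alpha> \<le> 1 \<and> (\<forall>i<M. \<forall>j<M. i \<noteq> j \<longrightarrow> \<bar>v i \<bullet> v j\<bar> = \<alpha>))"

definition gram :: "(nat \<Rightarrow> real^'r) \<Rightarrow> nat \<Rightarrow> nat \<Rightarrow> real" where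
  "gram v i j = v i \<bullet> v j"

definition pseudomoment4 :: "nat \<Rightarrow> (nat \<times> nat \<Rightarrow> nat \<times> nat \<Rightarrow> real) \<Rightarrow> bool" where
  "pseudomoment4 N Y \<longleftrightarrow>
     (\<forall>c :: nat \<times> nat \<Rightarrow> real.
        0 \<le> (\<Sum>p\<in>{..<N} \<times> {..<N}. \<Sum>q\<in>{..<N} \<times> {..<N}. c p * Y p q * c q)) \<and>
     (\<forall>i<N. \<forall>j<N. \<forall>k<N. \<forall>k'<N. Y (i, j) (k, k) = Y (i, j) (k', k')) \<and>
     (\<forall>i<N. Y (i, i) (i, i) = 1) \<and>
     (\<forall>(f :: nat \<Rightarrow> nat) \<sigma>. (\<forall>m<4. f m < N) \<longrightarrow> \<sigma> permutes {..<4} \<longrightarrow>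
        Y (f 0, f 1) (f 2, f 3) = Y (f (\<sigma> 0), f (\<sigma> 1)) (f (\<sigma> 2), f (\<sigma> 3)))"

definition extends4 :: "nat \<Rightarrow> (nat \<times> nat \<Rightarrow> nat \<times> nat \<Rightarrow> real) \<Rightarrow> (nat \<Rightarrow> nat \<Rightarrow> real) \<Rightarrow> bool" where
  "extends4 N Y X \<longleftrightarrow> pseudomoment4 N Y \<and> (\<forall>i<N. \<forall>j<N. Y (0, i) (0, j) = X i j)"

definition E4 :: "nat \<Rightarrow> (nat \<Rightarrow> nat \<Rightarrow> real) set" where
  "E4 N = {X. (\<forall>i<N. \<forall>j<N. X i j = X j i) \<and> (\<exists>Y. extends4 N Y X)}"

text \<open>Triangle inequalities  -s_i s_j X_ij - s_j s_k X_jk - s_i s_k X_ik \<le> 1,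
  indexed by (i,j,k,s) with i,j,k distinct in [N] and s \<in> {+-1}^N.
  Their left-hand sides are linear forms in the off-diagonal entries X_ab (a<b);
  tri_coeff gives the coefficient of X_ab.\<close>

definition tri_index :: "nat \<Rightarrow> (nat \<times> nat \<times> nat \<times> (nat \<Rightarrow> real)) set" where
  "tri_index N = {(i, j, k, s). i < N \<and> j < N \<and> k < N \<and> i \<noteq> j \<and> j \<noteq> k \<and> i \<noteq> k \<and>
                     (\<forall>x<N. s x = 1 \<or> s x = -1)}"

fun tri_coeff :: "nat \<times> nat \<times> nat \<times> (nat \<Rightarrow> real) \<Rightarrow> nat \<Rightarrow> nat \<Rightarrow> real" where
  "tri_coeff (i, j, k, s) a b =
     (if {a, b} = {i, j} then - s i * s j else 0) +
     (if {a, b} = {j, k} then - s j * s k else 0) +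
     (if {a, b} = {i, k} then - s i * s k else 0)"

text \<open>Coefficient of X_ab (a<b) in  sum_{i<j<28} sgn(Z_ij) X_{pi(i) pi(j)}.\<close>

definition etf_coeff :: "(nat \<Rightarrow> nat \<Rightarrow> real) \<Rightarrow> (nat \<Rightarrow> nat) \<Rightarrow> nat \<Rightarrow> nat \<Rightarrow> real" where
  "etf_coeff Z \<pi> a b = (\<Sum>i<28. \<Sum>j\<in>{i<..<28}. if {\<pi> i, \<pi> j} = {a, b} then sgn (Z i j) else 0)"

end

theory Submission
  imports Defs
begin

text \<open>
  The frame vectors have inner products \<open>\<plusminus>1/3\<close> and, being \<open>7 \<cdot> 8 / 2\<close> in number, form a projective
  2-design: the fourth moment \<open>\<Sum>i. (v i \<bullet> y) ^ 4\<close> is \<open>4/3 * (y \<bullet> y)\<^sup>2\<close>, because the difference of the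
  two 4-tensors has norm zero. For a sign vector \<open>x\<close> put \<open>y = \<Sum>i. x i v i\<close> and \<open>t = y \<bullet> y\<close>; since
  \<open>t = 28 + 2/3 * \<Sum>i<j. sgn (Z i j) x i x j\<close>, the claim is that the pseudoexpectation of \<open>t\<close> is at
  most \<open>308/3\<close>. Using the design identity, a sum of squares of quadratic polynomials in \<open>x\<close> equals
  \<open>c - c' * t\<close> on the cube, with \<open>c, c' > 0\<close> and \<open>c / c' < 308/3\<close>. To apply such an identity to a
  pseudomoment matrix, its entries are read as the Fourier coefficients of a linear functional on all
  functions on the cube; it is nonnegative on squares of quadratic polynomials.

  For the second part, the matrix with off-diagonal entries \<open>sgn (Z i j) / 3\<close> satisfies all triangle
  inequalities, but gives the value \<open>378 / 3 = 126 > 112\<close>.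
\<close>

section \<open>Equiangular tight frames of 28 vectors in dimension 7\<close>

lemma sum_swap_innermost:
  fixes f :: "'i \<Rightarrow> 'a::finite \<Rightarrow> 'a \<Rightarrow> 'a \<Rightarrow> 'a \<Rightarrow> real"
  shows "(\<Sum>a\<in>UNIV. \<Sum>b\<in>UNIV. \<Sum>c\<in>UNIV. \<Sum>d\<in>UNIV. \<Sum>i\<in>I. f i a b c d)
    = (\<Sum>i\<in>I. \<Sum>a\<in>UNIV. \<Sum>b\<in>UNIV. \<Sum>c\<in>UNIV. \<Sum>d\<in>UNIV. f i a b c d)"
  by (simp add: sum.swap[of _ I])

lemma sum_prod4:
  fixes f g h k :: "'a::finite \<Rightarrow> real"
  shows "(\<Sum>a\<in>UNIV. \<Sum>b\<in>UNIV. \<Sum>c\<in>UNIV. \<Sum>d\<in>UNIV. f a * g b * h c * k d)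
    = sum f UNIV * sum g UNIV * sum h UNIV * sum k UNIV"
  by (simp add: sum_distrib_left[symmetric] sum_distrib_right[symmetric])

text \<open>The fourth moment tensor of a standard Gaussian vector; up to a scalar it is the only
  fully symmetric 4-tensor invariant under rotations and reflections.\<close>

definition pairing_tensor :: "'a \<Rightarrow> 'a \<Rightarrow> 'a \<Rightarrow> 'a \<Rightarrow> real" where
  "pairing_tensor a b c d = (if a = b \<and> c = d then 1 else 0) + (if a = c \<and> b = d then 1 else 0)
    + (if a = d \<and> b = c then 1 else 0)"

lemma sum_pairing_tensor:
  fixes f :: "'a::finite \<Rightarrow> 'a \<Rightarrow> 'a \<Rightarrow> 'a \<Rightarrow> real"
  shows "(\<Sum>a\<in>UNIV. \<Sum>b\<in>UNIV. \<Sum>c\<in>UNIV. \<Sum>d\<in>UNIV. f a b c d * pairing_tensor a b c d)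
    = (\<Sum>a\<in>UNIV. \<Sum>b\<in>UNIV. f a a b b + f a b a b + f a b b a)"
proof -
  have "(\<Sum>d\<in>UNIV. f a b c d * pairing_tensor a b c d)
    = (if a = b then f a b c c else 0) + (if a = c then f a b c b else 0)
      + (if b = c then f a b c a else 0)" for a b c
  proof -
    have "f a b c d * pairing_tensor a b c d = (if c = d then if a = b then f a b c c else 0 else 0)
        + (if b = d then if a = c then f a b c b else 0 else 0)
        + (if a = d then if b = c then f a b c a else 0 else 0)" for d
      by (simp add: pairing_tensor_def distrib_left)
    then show ?thesis by (simp only: sum.distrib) simp
  qed
  moreover have "(\<Sum>c\<in>UNIV. (if a = b then f a b c c else 0) + (if a = c then f a b c b else 0)
      + (if b = c then f a b c a else 0))
    = (if a = b then \<Sum>c\<in>UNIV. f a a c c else 0) + f a b a b + f a b b a" for a b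
    by (simp add: sum.distrib)
  ultimately show ?thesis
    by (simp add: sum.distrib)
qed

section \<open>Second and fourth moments of the frame\<close>

context
  fixes v :: "nat \<Rightarrow> real^7"
  assumes etf: "is_ETF 28 v"
begin

lemma etf_unit: "i < 28 \<Longrightarrow> v i \<bullet> v i = 1"
  using etf by (simp add: is_ETF_def norm_eq_1)

text \<open>The coordinate form of tightness is contracted with \<open>a\<close> and
  \<open>b\<close>; 4 is the frame constant 28/7.\<close>

lemma etf_tight: "(\<Sum>i<28. (v i \<bullet> a) * (v i \<bullet> b)) = 4 * (a \<bullet> b)"
proof -
  have T: "(\<Sum>i<28. v i $ p * v i $ q) = (if p = q then 4 else 0)" for p q
    using etf by (simp add: is_ETF_def)
  have "(\<Sum>i<28. (v i \<bullet> a) * (v i \<bullet> b))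
      = (\<Sum>i<28. \<Sum>p\<in>UNIV. \<Sum>q\<in>UNIV. (v i $ p * v i $ q) * (a $ p * b $ q))"
    by (simp add: inner_vec_def sum_product mult_ac)
  also have "\<dots> = (\<Sum>p\<in>UNIV. \<Sum>q\<in>UNIV. (\<Sum>i<28. v i $ p * v i $ q) * (a $ p * b $ q))"
    by (simp add: sum.swap[of _ _ "{..<28}"] sum_distrib_right)
  also have "\<dots> = 4 * (a \<bullet> b)"
    by (simp add: T if_distrib[of "\<lambda>z. z * _"] inner_vec_def sum_distrib_left cong: if_cong)
  finally show ?thesis .
qed

text \<open>Tightness tested at \<open>v 0\<close> reads
  \<open>4 = 1 + 27 * \<alpha>\<^sup>2\<close>, which determines the common angle.\<close>

lemma etf_inner_sq:
  assumes "i < 28" "j < 28"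
  shows "(v i \<bullet> v j)\<^sup>2 = (if i = j then 1 else 1 / 9)"
proof -
  obtain \<alpha> where \<alpha>: "\<And>i j. i < 28 \<Longrightarrow> j < 28 \<Longrightarrow> i \<noteq> j \<Longrightarrow> \<bar>v i \<bullet> v j\<bar> = \<alpha>"
    using etf by (auto simp: is_ETF_def)
  have sq: "(v j \<bullet> v i)\<^sup>2 = \<alpha>\<^sup>2" if "i < 28" "j < 28" "i \<noteq> j" for i j
    using \<alpha>[of j i] that by (metis power2_abs)
  have "4 = (\<Sum>j<28. (v j \<bullet> v 0)\<^sup>2)"
    using etf_tight[of "v 0" "v 0"] etf_unit[of 0] by (simp add: power2_eq_square)
  also have "\<dots> = (v 0 \<bullet> v 0)\<^sup>2 + (\<Sum>j\<in>{..<28} - {0}. (v j \<bullet> v 0)\<^sup>2)"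
    by (rule sum.remove) auto
  also have "(\<Sum>j\<in>{..<28} - {0}. (v j \<bullet> v 0)\<^sup>2) = (\<Sum>j\<in>{..<28::nat} - {0}. \<alpha>\<^sup>2)"
    by (intro sum.cong refl sq) auto
  finally have "\<alpha>\<^sup>2 = 1 / 9"
    using etf_unit[of 0] by simp
  then show ?thesis
    using sq[of j i] assms etf_unit by simp
qed

text \<open>With \<open>F\<close> the moment tensor and \<open>G\<close> the pairing tensor, the
  entrywise inner products are 112/3 for \<open>F\<close> with itself, 84 for \<open>F\<close> with
  \<open>G\<close> and 189 for \<open>G\<close> with itself. The factor 4/9 = 84/189 projects
  \<open>F\<close> onto the line of \<open>G\<close>, and the squared norm of the remainder is 112/3
  - 84 * 84 / 189 = 0.\<close>

lemma etf_fourth_moment_tensor: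
  "(\<Sum>i<28. v i $ a * v i $ b * v i $ c * v i $ d) = 4 / 9 * pairing_tensor a b c d"
proof -
  define F where "F = (\<lambda>a b c d. \<Sum>i<28. v i $ a * v i $ b * v i $ c * v i $ d)"
  define G :: "7 \<Rightarrow> 7 \<Rightarrow> 7 \<Rightarrow> 7 \<Rightarrow> real" where "G = pairing_tensor"
  have n4: "(\<Sum>i<28. \<Sum>j<28. (v i \<bullet> v j) ^ 4) = 112 / 3"
  proof -
    have "(v i \<bullet> v j) ^ 4 = 1 / 81 + (if i = j then 80 / 81 else 0)" if "i < 28" "j < 28" for i j
    proof -
      have "(v i \<bullet> v j) ^ 4 = ((v i \<bullet> v j)\<^sup>2)\<^sup>2" by simp
      then show ?thesis using etf_inner_sq[OF that] by (simp add: power2_eq_square)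
    qed
    then have "(\<Sum>i<28. \<Sum>j<28. (v i \<bullet> v j) ^ 4)
      = (\<Sum>i<28. \<Sum>j<28::nat. 1 / 81 + (if i = j then 80 / 81 else 0 :: real))" by simp
    also have "\<dots> = 112 / 3" by (simp add: sum.distrib)
    finally show ?thesis .
  qed
  \<comment> \<open>\<open>F\<close> is a sum of fourth tensor powers of the \<open>v i\<close>, so
    its squared norm is the sum of the fourth powers of all inner products.\<close>
  have FF: "(\<Sum>a\<in>UNIV. \<Sum>b\<in>UNIV. \<Sum>c\<in>UNIV. \<Sum>d\<in>UNIV. F a b c d * F a b c d) = 112 / 3"
  proof -
    have "F a b c d * F a b c d = (\<Sum>i<28. \<Sum>j<28. (v i $ a * v j $ a) * (v i $ b * v j $ b)
        * (v i $ c * v j $ c) * (v i $ d * v j $ d))" for a b c d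
      unfolding F_def by (simp add: sum_product mult_ac)
    then show ?thesis
      by (simp only: sum_swap_innermost sum_prod4 n4[symmetric] inner_vec_def inner_real_def power4_eq_xxxx)
  qed
  have FG: "(\<Sum>a\<in>UNIV. \<Sum>b\<in>UNIV. \<Sum>c\<in>UNIV. \<Sum>d\<in>UNIV. F a b c d * G a b c d) = 84"
  proof -
    have "F a a b b + F a b a b + F a b b a = (\<Sum>i<28. 3 * ((v i $ a * v i $ a) * (v i $ b * v i $ b)))" for a b
      unfolding F_def by (simp add: sum.distrib[symmetric] mult_ac)
    then have "(\<Sum>a\<in>UNIV. \<Sum>b\<in>UNIV. \<Sum>c\<in>UNIV. \<Sum>d\<in>UNIV. F a b c d * G a b c d)
        = (\<Sum>i<28. 3 * ((v i \<bullet> v i) * (v i \<bullet> v i)))"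
      unfolding G_def sum_pairing_tensor
      by (simp only: sum.swap[of _ "{..<28}"] inner_vec_def inner_real_def sum_product)
        (simp only: sum_distrib_left)
    then show ?thesis by (simp add: etf_unit)
  qed
  have GG: "(\<Sum>a\<in>UNIV. \<Sum>b\<in>UNIV. \<Sum>c\<in>UNIV. \<Sum>d\<in>UNIV. G a b c d * G a b c d) = 189"
  proof -
    have "G a a b b + G a b a b + G a b b a = 3 + (if a = b then 6 else 0)" for a b
      by (simp add: G_def pairing_tensor_def)
    then show ?thesis
      by (simp add: G_def sum_pairing_tensor sum.distrib)
  qed
  have "(\<Sum>a\<in>UNIV. \<Sum>b\<in>UNIV. \<Sum>c\<in>UNIV. \<Sum>d\<in>UNIV. (F a b c d - 4 / 9 * G a b c d)\<^sup>2) =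
     (\<Sum>a\<in>UNIV. \<Sum>b\<in>UNIV. \<Sum>c\<in>UNIV. \<Sum>d\<in>UNIV. F a b c d * F a b c d)
     - 8 / 9 * (\<Sum>a\<in>UNIV. \<Sum>b\<in>UNIV. \<Sum>c\<in>UNIV. \<Sum>d\<in>UNIV. F a b c d * G a b c d)
     + 16 / 81 * (\<Sum>a\<in>UNIV. \<Sum>b\<in>UNIV. \<Sum>c\<in>UNIV. \<Sum>d\<in>UNIV. G a b c d * G a b c d)"
    by (simp only: sum_distrib_left sum.distrib[symmetric] sum_subtractf[symmetric])
      (simp add: power2_eq_square algebra_simps)
  also have "\<dots> = 0" by (simp add: FF FG GG)
  finally have "F a b c d - 4 / 9 * G a b c d = 0"
    by (simp add: sum_nonneg_eq_0_iff sum_nonneg)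
  then show ?thesis
    by (simp add: F_def G_def)
qed

text \<open>The tensor identity is contracted with four copies of \<open>y\<close>. Each of the
  three pairings contributes \<open>(y \<bullet> y)\<^sup>2\<close>, and 3 * 4/9 = 4/3.\<close>

lemma etf_fourth_moment: "(\<Sum>i<28. (v i \<bullet> y) ^ 4) = 4 / 3 * (y \<bullet> y)\<^sup>2"
proof -
  have "(v i \<bullet> y) ^ 4 = (\<Sum>a\<in>UNIV. \<Sum>b\<in>UNIV. \<Sum>c\<in>UNIV. \<Sum>d\<in>UNIV.
      (v i $ a * y $ a) * (v i $ b * y $ b) * (v i $ c * y $ c) * (v i $ d * y $ d))" for i
    by (simp add: sum_prod4 inner_vec_def power4_eq_xxxx)
  then have "(\<Sum>i<28. (v i \<bullet> y) ^ 4) = (\<Sum>a\<in>UNIV. \<Sum>b\<in>UNIV. \<Sum>c\<in>UNIV. \<Sum>d\<in>UNIV.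
      (\<Sum>i<28. v i $ a * v i $ b * v i $ c * v i $ d) * (y $ a * y $ b * y $ c * y $ d))"
    by (simp only: sum_swap_innermost[symmetric] sum_distrib_right) (simp only: mult_ac)
  also have "\<dots> = 4 / 9 * (\<Sum>a\<in>UNIV. \<Sum>b\<in>UNIV. \<Sum>c\<in>UNIV. \<Sum>d\<in>UNIV.
      (y $ a * y $ b * y $ c * y $ d) * pairing_tensor a b c d)"
    unfolding etf_fourth_moment_tensor sum_distrib_left by (simp add: mult_ac)
  also have "\<dots> = 4 / 9 * (3 * (\<Sum>a\<in>UNIV. \<Sum>b\<in>UNIV. (y $ a * y $ a) * (y $ b * y $ b)))"
    unfolding sum_pairing_tensor by (simp add: sum_distrib_left mult_ac)
  also have "\<dots> = 4 / 3 * (y \<bullet> y)\<^sup>2"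
    by (simp add: inner_vec_def power2_eq_square sum_product)
  finally show ?thesis .
qed

text \<open>
  The squared forms nearly vanish at the best sign vectors \<open>x i = sgn (v i \<bullet> v k)\<close>, for which
  \<open>y \<bullet> y = 100\<close>. Their coefficients are rounded, under the constraint that the sums
  \<open>\<Sum>i. x i * h i ^ 3\<close>, which are not a function of \<open>y \<bullet> y\<close>, cancel.
\<close>

lemma etf_sum_of_squares:
  fixes x :: "nat \<Rightarrow> real"
  assumes x: "\<And>i. i < 28 \<Longrightarrow> x i * x i = 1"
  defines "y \<equiv> \<Sum>i<28. x i *\<^sub>R v i"
  defines "h \<equiv> \<lambda>i. v i \<bullet> y"
  defines "\<delta> \<equiv> \<lambda>i. 5 / 4 - x i * h i / 4 - 9 / 200 * (h i * h i)"
  shows "(\<Sum>j<28. \<Sum>k<28. (x j * x k - h j * h k / 10 - (v j \<bullet> v k) * (\<delta> j + \<delta> k))\<^sup>2)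
    = 1484 - 349 / 45 * (y \<bullet> y) - 3083 / 45000 * (y \<bullet> y)\<^sup>2"
proof -
  define t where "t = y \<bullet> y"
  define C where "C = (\<Sum>i<28. x i * h i ^ 3)"
  have Zx: "(\<Sum>k<28. (v j \<bullet> v k) * x k) = h j" for j
    by (simp add: h_def y_def inner_sum_right mult_ac)
  \<comment> \<open>By tightness the Gram matrix is 4 times a projection, and \<open>h\<close> lies
    in its range by \<open>Zx\<close>.\<close>
  have Zh: "(\<Sum>k<28. (v j \<bullet> v k) * h k) = 4 * h j" for j
    using etf_tight[of "v j" y] by (simp add: h_def inner_commute[of "v j"])
  have sw: "(\<Sum>i<28. x i * h i) = t"
    by (simp add: h_def t_def y_def inner_sum_left)
  have su: "(\<Sum>i<28. h i * h i) = 4 * t"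
    using etf_tight[of y y] by (simp add: h_def t_def)
  \<comment> \<open>The design identity makes this quartic sum a function of
    \<open>t\<close>.\<close>
  have su2: "(\<Sum>i<28. h i * h i * (h i * h i)) = 4 / 3 * t\<^sup>2"
    using etf_fourth_moment[of y] by (simp add: h_def t_def power4_eq_xxxx mult_ac)
  have sd: "(\<Sum>i<28. \<delta> i) = 35 - 43 / 100 * t"
    unfolding \<delta>_def by (simp add: sum_subtractf sum_divide_distrib[symmetric] sum_distrib_left[symmetric] sw su)
  have xx: "(\<Sum>i<28. x i * x i * g i) = (\<Sum>i<28. g i)" for g
    using x by simp
  have sdw: "(\<Sum>i<28. \<delta> i * (x i * h i)) = t / 4 - 9 / 200 * C"
  proof -
    have "(\<Sum>i<28. \<delta> i * (x i * h i)) = 5 / 4 * (\<Sum>i<28. x i * h i)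
       - 1 / 4 * (\<Sum>i<28. x i * x i * (h i * h i)) - 9 / 200 * C"
      unfolding \<delta>_def C_def
      by (simp add: sum_distrib_left sum_subtractf[symmetric] algebra_simps power3_eq_cube)
    then show ?thesis by (simp add: xx sw su)
  qed
  have sdu: "(\<Sum>i<28. \<delta> i * (h i * h i)) = 5 * t - C / 4 - 3 / 50 * t\<^sup>2"
  proof -
    have "(\<Sum>i<28. \<delta> i * (h i * h i)) = 5 / 4 * (\<Sum>i<28. h i * h i)
       - 1 / 4 * C - 9 / 200 * (\<Sum>i<28. h i * h i * (h i * h i))"
      unfolding \<delta>_def C_def
      by (simp add: sum_distrib_left sum_subtractf[symmetric] algebra_simps power3_eq_cube)
    then show ?thesis by (simp add: su su2)
  qed
  have sd2: "(\<Sum>i<28. \<delta> i * \<delta> i) = 5 / 4 * (35 - 43 / 100 * t) - (t / 4 - 9 / 200 * C) / 4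
      - 9 / 200 * (5 * t - C / 4 - 3 / 50 * t\<^sup>2)"
  proof -
    \<comment> \<open>Only one of the two factors is expanded, so that \<open>sd\<close>,
      \<open>sdw\<close> and \<open>sdu\<close> can be reused.\<close>
    have "(\<Sum>i<28. \<delta> i * \<delta> i) = (\<Sum>i<28. 5 / 4 * \<delta> i - 1 / 4 * (\<delta> i * (x i * h i)) - 9 / 200 * (\<delta> i * (h i * h i)))"
      by (rule sum.cong[OF refl], subst (2) \<delta>_def) (simp add: algebra_simps)
    also have "\<dots> = 5 / 4 * (\<Sum>i<28. \<delta> i) - 1 / 4 * (\<Sum>i<28. \<delta> i * (x i * h i)) - 9 / 200 * (\<Sum>i<28. \<delta> i * (h i * h i))"
      by (simp only: sum_distrib_left sum_subtractf)
    finally show ?thesis by (simp add: sd sdw sdu)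
  qed
  have s1: "(\<Sum>j<28. \<Sum>k<28. (x j * x j) * (x k * x k)) = 784"
    by (simp add: x)
  have s2: "(\<Sum>j<28. \<Sum>k<28. (h j * h j) * (h k * h k)) = 16 * t\<^sup>2"
    by (simp add: sum_product[symmetric] su power2_eq_square)
  have s3: "(\<Sum>j<28. \<Sum>k<28. (v j \<bullet> v k)\<^sup>2 * (\<delta> j + \<delta> k)\<^sup>2)
      = 88 / 9 * (\<Sum>i<28. \<delta> i * \<delta> i) + 2 / 9 * (\<Sum>i<28. \<delta> i)\<^sup>2"
  proof -
    \<comment> \<open>The squared Gram entries are 1/9 plus 8/9 on the diagonal, where the second
      factor is \<open>4 * (\<delta> j * \<delta> j)\<close>; this gives the 32/9.\<close>
    have "(\<Sum>j<28. \<Sum>k<28. (v j \<bullet> v k)\<^sup>2 * (\<delta> j + \<delta> k)\<^sup>2)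
      = (\<Sum>j<28. \<Sum>k<28. 1 / 9 * (\<delta> j * \<delta> j) + 1 / 9 * (\<delta> k * \<delta> k) + 2 / 9 * (\<delta> j * \<delta> k)
          + (if k = j then 32 / 9 * (\<delta> j * \<delta> j) else 0))"
      by (intro sum.cong refl)
        (simp add: etf_inner_sq, simp add: power2_eq_square algebra_simps)
    also have "\<dots> = (\<Sum>j<28. 28 / 9 * (\<delta> j * \<delta> j)) + 28 / 9 * (\<Sum>k<28. \<delta> k * \<delta> k)
        + 2 / 9 * (\<Sum>j<28. \<Sum>k<28. \<delta> j * \<delta> k) + (\<Sum>j<28. 32 / 9 * (\<delta> j * \<delta> j))"
      by (simp add: sum.distrib sum_distrib_left) (simp flip: sum.distrib)
    also have "\<dots> = 88 / 9 * (\<Sum>i<28. \<delta> i * \<delta> i) + 2 / 9 * (\<Sum>i<28. \<delta> i)\<^sup>2"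
      by (simp only: sum_distrib_left[symmetric] sum_product power2_eq_square)
    finally show ?thesis .
  qed
  have s4: "(\<Sum>j<28. \<Sum>k<28. (x j * h j) * (x k * h k)) = t\<^sup>2"
    by (simp add: sum_product[symmetric] sw power2_eq_square)
  have sym: "(\<Sum>j<28. \<Sum>k<28. g j * g k * (v j \<bullet> v k) * (\<delta> j + \<delta> k))
      = 2 * (\<Sum>j<28. \<delta> j * g j * (\<Sum>k<28. (v j \<bullet> v k) * g k))" for g :: "nat \<Rightarrow> real"
  proof -
    have "(\<Sum>j<28. \<Sum>k<28. g j * g k * (v j \<bullet> v k) * (\<delta> j + \<delta> k)) =
      (\<Sum>j<28. \<Sum>k<28. g j * g k * (v j \<bullet> v k) * \<delta> j) + (\<Sum>j<28. \<Sum>k<28. g j * g k * (v j \<bullet> v k) * \<delta> k)"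
      by (simp add: distrib_left sum.distrib)
    also have "(\<Sum>j<28. \<Sum>k<28. g j * g k * (v j \<bullet> v k) * \<delta> k) = (\<Sum>j<28. \<Sum>k<28. g j * g k * (v j \<bullet> v k) * \<delta> j)"
      by (subst sum.swap) (simp add: inner_commute mult_ac)
    finally show ?thesis by (simp add: sum_distrib_left mult_ac)
  qed
  have s5: "(\<Sum>j<28. \<Sum>k<28. x j * x k * (v j \<bullet> v k) * (\<delta> j + \<delta> k)) = 2 * (\<Sum>j<28. \<delta> j * (x j * h j))"
    unfolding sym Zx by (simp add: mult_ac)
  have s6: "(\<Sum>j<28. \<Sum>k<28. h j * h k * (v j \<bullet> v k) * (\<delta> j + \<delta> k)) = 8 * (\<Sum>j<28. \<delta> j * (h j * h j))"
    unfolding sym Zh by (simp add: mult_ac sum_distrib_left)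
  have "(\<Sum>j<28. \<Sum>k<28. (x j * x k - h j * h k / 10 - (v j \<bullet> v k) * (\<delta> j + \<delta> k))\<^sup>2)
    = (\<Sum>j<28. \<Sum>k<28. (x j * x j) * (x k * x k) + 1 / 100 * ((h j * h j) * (h k * h k))
        + (v j \<bullet> v k)\<^sup>2 * (\<delta> j + \<delta> k)\<^sup>2 - 1 / 5 * ((x j * h j) * (x k * h k))
        - 2 * (x j * x k * (v j \<bullet> v k) * (\<delta> j + \<delta> k))
        + 1 / 5 * (h j * h k * (v j \<bullet> v k) * (\<delta> j + \<delta> k)))"
    by (intro sum.cong refl) (simp add: power2_eq_square field_simps)
  also have "\<dots> = 784 + 1 / 100 * (16 * t\<^sup>2) + (88 / 9 * (\<Sum>i<28. \<delta> i * \<delta> i) + 2 / 9 * (\<Sum>i<28. \<delta> i)\<^sup>2)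
      - 1 / 5 * t\<^sup>2 - 2 * (2 * (\<Sum>j<28. \<delta> j * (x j * h j))) + 1 / 5 * (8 * (\<Sum>j<28. \<delta> j * (h j * h j)))"
    unfolding s1[symmetric] s2[symmetric] s3[symmetric] s5[symmetric] s6[symmetric]
    unfolding s4[symmetric]
    by (simp only: sum.distrib sum_subtractf sum_distrib_left)
  \<comment> \<open>\<open>C\<close> cancels here: its coefficients are 11/50 from the sum of
    \<open>\<delta> i * \<delta> i\<close>, 9/50 from \<open>sdw\<close> and -2/5 from
    \<open>sdu\<close>.\<close>
  also have "\<dots> = 1484 - 349 / 45 * t - 3083 / 45000 * t\<^sup>2"
    unfolding sd sdw sdu sd2 by (simp add: power2_eq_square field_simps)
  finally show ?thesis by (simp add: t_def)
qed

end

section \<open>Pseudomoment matrices as linear functionals on the cube\<close>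

text \<open>A sign vector is encoded by the set \<open>U\<close> of its negative coordinates, so
  that the cube is a power set.\<close>

definition cube_coord :: "nat set \<Rightarrow> nat \<Rightarrow> real" where
  "cube_coord U i = (if i \<in> U then -1 else 1)"

definition character :: "nat set \<Rightarrow> nat set \<Rightarrow> real" where
  "character A U = (\<Prod>i\<in>A. cube_coord U i)"

text \<open>Coordinates square to 1 on the cube, so a monomial depends only on the parities of its
  exponents; these are the variables that survive.\<close>

definition odd_support :: "'a list \<Rightarrow> 'a set" where
  "odd_support xs = {a. odd (count (mset xs) a)}"

lemma cube_coord_square: "cube_coord U i * cube_coord U i = 1"
  by (simp add: cube_coord_def)

text \<open>Both sides are -1 to the power \<open>card (A \<inter> U)\<close>. A product over
  \<open>U\<close> is the form in which a sum over all \<open>U\<close> factorizes.\<close>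

lemma character_eq_prod_restrict:
  assumes "finite A" "finite U"
  shows "character A U = (\<Prod>i\<in>U. if i \<in> A then -1 else 1)"
  unfolding character_def cube_coord_def
  using prod.inter_restrict[OF assms(1), of "\<lambda>_. -1::real" U]
    prod.inter_restrict[OF assms(2), of "\<lambda>_. -1::real" A]
  by (simp add: Int_commute)

text \<open>The sum over \<open>U\<close> is the expansion of a product over
  \<open>i \<in> I\<close> of \<open>f i + 1\<close>, and a factor vanishes exactly when
  \<open>i\<close> lies in one of \<open>A\<close>, \<open>B\<close> but not in both.\<close>

lemma character_orthogonal:
  assumes "finite I" "A \<subseteq> I" "B \<subseteq> I"
  shows "(\<Sum>U\<in>Pow I. character A U * character B U) = (if A = B then 2 ^ card I else 0)"
proof -
  define f where "f i = (if i \<in> A then -1 else 1) * (if i \<in> B then -1 else 1 :: real)" for i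
  have fin: "finite A" "finite B" using assms finite_subset by blast+
  have "(\<Sum>U\<in>Pow I. character A U * character B U) = (\<Sum>U\<in>Pow I. (\<Prod>i\<in>U. f i) * (\<Prod>i\<in>I - U. 1))"
  proof (rule sum.cong[OF refl])
    fix U assume "U \<in> Pow I"
    then have "finite U" using assms(1) finite_subset by blast
    then show "character A U * character B U = (\<Prod>i\<in>U. f i) * (\<Prod>i\<in>I - U. 1)"
      by (simp add: character_eq_prod_restrict fin f_def prod.distrib)
  qed
  also have "\<dots> = (\<Prod>i\<in>I. f i + 1)"
    by (rule prod_add[OF assms(1), symmetric])
  also have "\<dots> = (if A = B then 2 ^ card I else 0)"
  proof (cases "A = B")
    case True
    then have "f i = 1" for i by (simp add: f_def)
    then show ?thesis using True by simp
  next
    case False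
    then obtain i where "i \<in> I" "(i \<in> A) \<noteq> (i \<in> B)" using assms by blast
    then have "i \<in> I" "f i + 1 = 0" by (auto simp: f_def)
    then show ?thesis using False assms(1) by (auto intro: prod_zero)
  qed
  finally show ?thesis .
qed

lemma odd_support_subset: "odd_support xs \<subseteq> set xs"
  by (auto simp: odd_support_def) (metis count_mset_0_iff even_zero)

lemma odd_support_distinct: "distinct xs \<Longrightarrow> odd_support xs = set xs"
  by (auto simp: odd_support_def distinct_count_atmost_1 split: if_splits)

lemma prod_list_cube_coord:
  "prod_list (map (cube_coord U) xs) = character (odd_support xs) U"
proof (induction xs)
  case Nil
  then show ?case by (simp add: odd_support_def character_def)
next
  case (Cons a xs)
  let ?S = "odd_support xs"
  have fin: "finite ?S" by (rule finite_subset[OF odd_support_subset finite_set])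
  show ?case
  proof (cases "a \<in> ?S")
    case True
    then have "odd_support (a # xs) = ?S - {a}"
      by (auto simp: odd_support_def)
    moreover have "character ?S U = cube_coord U a * character (?S - {a}) U"
      unfolding character_def by (rule prod.remove[OF fin True])
    ultimately show ?thesis
      using Cons.IH by (simp add: mult.assoc[symmetric] cube_coord_square)
  next
    case False
    then have "odd_support (a # xs) = insert a ?S"
      by (auto simp: odd_support_def)
    then show ?thesis
      using Cons.IH False fin by (simp add: character_def)
  qed
qed

lemma not_distinct_length4:
  assumes "length xs = 4" "\<not> distinct xs"
  obtains p q r where "mset xs = mset [p, q, r, r]"
proof -
  obtain a b c d where xs: "xs = [a, b, c, d]"
    using assms(1) by (auto simp: numeral_eq_Suc length_Suc_conv)
  then consider "a = b" | "a = c" | "a = d" | "b = c" | "b = d" | "c = d"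
    using assms(2) by auto
  then show thesis
  proof cases
    case 1 then show ?thesis using that[of c d a] xs by simp
  next
    case 2 then show ?thesis using that[of b d a] xs by simp
  next
    case 3 then show ?thesis using that[of b c a] xs by simp
  next
    case 4 then show ?thesis using that[of a d b] xs by simp
  next
    case 5 then show ?thesis using that[of a c b] xs by simp
  next
    case 6 then show ?thesis using that[of a b c] xs by simp
  qed
qed

section \<open>Moments of degree 4 monomials\<close>

lemma
  fixes f :: "nat \<Rightarrow> nat"
  assumes "pseudomoment4 N Y"
  shows pseudomoment4_psd:
      "0 \<le> (\<Sum>p\<in>{..<N} \<times> {..<N}. \<Sum>q\<in>{..<N} \<times> {..<N}. c p * Y p q * c q)"
    and pseudomoment4_repeat:
      "\<lbrakk>i < N; j < N; k < N; k' < N\<rbrakk> \<Longrightarrow> Y (i, j) (k, k) = Y (i, j) (k', k')"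
    and pseudomoment4_diag: "i < N \<Longrightarrow> Y (i, i) (i, i) = 1"
    and pseudomoment4_permute:
      "\<lbrakk>\<And>m. m < 4 \<Longrightarrow> f m < N; \<sigma> permutes {..<4}\<rbrakk> \<Longrightarrow>
        Y (f 0, f 1) (f 2, f 3) = Y (f (\<sigma> 0), f (\<sigma> 1)) (f (\<sigma> 2), f (\<sigma> 3))"
  by (fact assms[unfolded pseudomoment4_def, THEN conjunct1, rule_format]
      assms[unfolded pseudomoment4_def, THEN conjunct2, THEN conjunct1, rule_format]
      assms[unfolded pseudomoment4_def, THEN conjunct2, THEN conjunct2, THEN conjunct1, rule_format]
      assms[unfolded pseudomoment4_def, THEN conjunct2, THEN conjunct2, THEN conjunct2, rule_format])+

text \<open>Positivity of \<open>n\<close> provides the index 0, whose repetition pads monomials of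
  lower degree to degree 4.\<close>

locale pseudomoment =
  fixes n :: nat and Y :: "nat \<times> nat \<Rightarrow> nat \<times> nat \<Rightarrow> real"
  assumes pseudomoment: "pseudomoment4 n Y" and n_pos: "0 < n"
begin

text \<open>Indexing by lists of length 4 turns invariance under permutations into dependence on
  \<open>mset\<close> alone.\<close>

definition moment :: "nat list \<Rightarrow> real" where
  "moment xs = Y (xs ! 0, xs ! 1) (xs ! 2, xs ! 3)"

lemma moment_permute:
  assumes "mset xs = mset ys" "length ys = 4" "set ys \<subseteq> {..<n}"
  shows "moment xs = moment ys"
proof -
  obtain \<sigma> where \<sigma>: "\<sigma> permutes {..<length ys}" "permute_list \<sigma> ys = xs"
    using mset_eq_permutation[OF assms(1)] .
  have "ys ! m < n" if "m < 4" for m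
    using subsetD[OF assms(3), of "ys ! m"] assms(2) that by simp
  moreover have "\<sigma> permutes {..<4}" using \<sigma>(1) assms(2) by simp
  ultimately have "Y (ys ! 0, ys ! 1) (ys ! 2, ys ! 3) = Y (ys ! \<sigma> 0, ys ! \<sigma> 1) (ys ! \<sigma> 2, ys ! \<sigma> 3)"
    by (rule pseudomoment4_permute[OF pseudomoment])
  then show ?thesis
    using \<sigma>(2)[symmetric] assms(2) \<sigma>(1) by (simp add: moment_def permute_list_nth)
qed

lemma moment_repeat:
  assumes "p < n" "q < n" "r < n" "s < n"
  shows "moment [p, q, r, r] = moment [p, q, s, s]"
proof -
  have "Y (p, q) (r, r) = Y (p, q) (s, s)"
    by (rule pseudomoment4_repeat[OF pseudomoment assms])
  then show ?thesis by (simp add: moment_def)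
qed

lemma moment_square: "p < n \<Longrightarrow> r < n \<Longrightarrow> moment [p, p, r, r] = 1"
  using moment_repeat[of p p r p] pseudomoment4_diag[OF pseudomoment]
  by (simp add: moment_def)

text \<open>A repeated index \<open>r\<close> can be moved to the last two places and then replaced
  by 0, which leaves a moment of degree 2, or 1 if the other two indices agree as well.\<close>

lemma moment_not_distinct:
  assumes "length xs = 4" "set xs \<subseteq> {..<n}" "\<not> distinct xs"
  obtains p q where "p < n" "q < n" "odd_support xs = (if p = q then {} else {p, q})"
    "moment xs = (if p = q then 1 else moment [p, q, 0, 0])"
proof -
  obtain p q r where m: "mset xs = mset [p, q, r, r]"
    using not_distinct_length4[OF assms(1,3)] .
  then have "set xs = {p, q, r}"
    by (metis list.set(1) list.set(2) insert_absorb2 mset_eq_setD)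
  then have lt: "p < n" "q < n" "r < n" using assms(2) by auto
  have "odd_support xs = (if p = q then {} else {p, q})"
    unfolding odd_support_def m by (auto split: if_splits)
  moreover have "moment xs = (if p = q then 1 else moment [p, q, 0, 0])"
    using moment_permute[OF m] lt moment_repeat[of p q r 0] moment_square n_pos by simp
  ultimately show thesis using that lt by blast
qed

text \<open>This makes a moment a function of the character that its monomial represents. A support
  of size 4 occurs exactly for distinct indices and determines the list up to order; otherwise both
  moments reduce to degree at most 2.\<close>

lemma moment_odd_support:
  assumes xs: "length xs = 4" "set xs \<subseteq> {..<n}" and ys: "length ys = 4" "set ys \<subseteq> {..<n}"
    and eq: "odd_support xs = odd_support ys"
  shows "moment xs = moment ys"
proof -
  have small: "card (odd_support zs) \<noteq> 4"
    if zs: "length zs = 4" "set zs \<subseteq> {..<n}" "\<not> distinct zs" for zs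
  proof -
    obtain p q where "odd_support zs = (if p = q then {} else {p, q})"
      using moment_not_distinct[OF zs] by metis
    then show ?thesis by simp
  qed
  have full: "card (odd_support zs) = 4" if "length zs = 4" "distinct zs" for zs :: "nat list"
    using that by (simp add: odd_support_distinct distinct_card)
  show ?thesis
  proof (cases "distinct xs")
    case True
    then have d: "distinct ys" using small[OF ys] full[OF xs(1)] eq by auto
    then have "mset xs = mset ys"
      using True eq by (simp add: odd_support_distinct set_eq_iff_mset_eq_distinct)
    then show ?thesis by (rule moment_permute[OF _ ys])
  next
    case False
    then have d: "\<not> distinct ys" using small[OF xs] full[OF ys(1)] eq by auto
    obtain p q where pq: "p < n" "q < n" "odd_support xs = (if p = q then {} else {p, q})"
      "moment xs = (if p = q then 1 else moment [p, q, 0, 0])"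
      using moment_not_distinct[OF xs False] .
    obtain p' q' where pq': "p' < n" "q' < n" "odd_support ys = (if p' = q' then {} else {p', q'})"
      "moment ys = (if p' = q' then 1 else moment [p', q', 0, 0])"
      using moment_not_distinct[OF ys d] .
    \<comment> \<open>Equal supports identify the two pairs only up to order.\<close>
    have "moment [p, q, 0, 0] = moment [q, p, 0, 0]"
      by (rule moment_permute) (use pq n_pos in auto)
    then show ?thesis
      using pq pq' eq by (auto simp: doubleton_eq_iff split: if_splits)
  qed
qed

text \<open>
  The value is arbitrary for sets \<open>A\<close> that are not the odd support of a monomial of degree 4;
  this only affects \<open>pexp\<close> on functions of higher degree.
\<close>

definition char_moment :: "nat set \<Rightarrow> real" where
  "char_moment A = moment (SOME xs. length xs = 4 \<and> set xs \<subseteq> {..<n} \<and> odd_support xs = A)"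

text \<open>The average of \<open>F\<close> over the cube against the signed density with Fourier
  coefficients \<open>char_moment\<close>. Being defined on functions rather than polynomials, it
  respects every identity that holds pointwise on the cube.\<close>

definition pexp :: "(nat set \<Rightarrow> real) \<Rightarrow> real" where
  "pexp F = (\<Sum>U\<in>Pow {..<n}. F U * (\<Sum>A\<in>Pow {..<n}. char_moment A * character A U)) / 2 ^ n"

lemma pexp_cmult: "pexp (\<lambda>U. c * F U) = c * pexp F"
  by (simp add: pexp_def sum_distrib_left mult.assoc)

lemma pexp_add: "pexp (\<lambda>U. F U + G U) = pexp F + pexp G"
  by (simp add: pexp_def distrib_right sum.distrib add_divide_distrib)

lemma pexp_sum: "pexp (\<lambda>U. \<Sum>k\<in>K. F k U) = (\<Sum>k\<in>K. pexp (F k))"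
  by (simp add: pexp_def sum_distrib_right sum.swap[of _ K] sum_divide_distrib)

lemma pexp_monomial:
  assumes "length xs = 4" "set xs \<subseteq> {..<n}"
  shows "pexp (\<lambda>U. prod_list (map (cube_coord U) xs)) = moment xs"
proof -
  let ?A = "odd_support xs"
  have A: "?A \<subseteq> {..<n}" by (rule order_trans[OF odd_support_subset assms(2)])
  have "pexp (\<lambda>U. prod_list (map (cube_coord U) xs))
    = (\<Sum>B\<in>Pow {..<n}. char_moment B * (\<Sum>U\<in>Pow {..<n}. character ?A U * character B U)) / 2 ^ n"
    unfolding pexp_def prod_list_cube_coord sum_distrib_left
    by (subst sum.swap) (simp add: mult_ac)
  also have "\<dots> = (\<Sum>B\<in>Pow {..<n}. if B = ?A then char_moment B * 2 ^ n else 0) / 2 ^ n"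
    using A by (intro arg_cong2[where f = "(/)"] sum.cong refl) (auto simp: character_orthogonal)
  also have "\<dots> = char_moment ?A"
    using A by (simp add: sum.delta)
  also have "\<dots> = moment xs"
  proof -
    let ?P = "\<lambda>ys. length ys = 4 \<and> set ys \<subseteq> {..<n} \<and> odd_support ys = ?A"
    \<comment> \<open>The list chosen in \<open>char_moment\<close> may differ from
      \<open>xs\<close>, but it has the same odd support.\<close>
    have "?P (SOME ys. ?P ys)" by (rule someI[of ?P xs]) (use assms in simp)
    then show ?thesis unfolding char_moment_def
      by (intro moment_odd_support assms) auto
  qed
  finally show ?thesis .
qed

lemma pexp_monomial4:
  assumes "i < n" "j < n" "k < n" "l < n"
  shows "pexp (\<lambda>U. cube_coord U i * cube_coord U j * (cube_coord U k * cube_coord U l)) = Y (i, j) (k, l)"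
  using pexp_monomial[of "[i, j, k, l]"] assms by (simp add: moment_def mult.assoc)

lemma pexp_monomial2:
  assumes "i < n" "j < n"
  shows "pexp (\<lambda>U. cube_coord U i * cube_coord U j) = Y (i, j) (0, 0)"
  using pexp_monomial4[OF assms n_pos n_pos] by (simp add: cube_coord_square)

lemma pexp_const: "pexp (\<lambda>U. c) = c"
proof -
  have "pexp (\<lambda>U. 1) = 1"
    using pexp_monomial2[OF n_pos n_pos] pseudomoment4_diag[OF pseudomoment n_pos]
    by (simp add: cube_coord_square)
  then show ?thesis using pexp_cmult[of c "\<lambda>_. 1"] by simp
qed

text \<open>The coefficients are indexed by pairs like the rows of \<open>Y\<close>, so a square
  becomes the quadratic form of \<open>Y\<close>. Constants are included because coordinates square
  to 1.\<close>

definition quadratic :: "(nat set \<Rightarrow> real) \<Rightarrow> bool" where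
  "quadratic f \<longleftrightarrow> (\<exists>c. \<forall>U. f U =
     (\<Sum>p\<in>{..<n} \<times> {..<n}. c p * (cube_coord U (fst p) * cube_coord U (snd p))))"

lemma pexp_square_nonneg:
  assumes "quadratic f"
  shows "0 \<le> pexp (\<lambda>U. (f U)\<^sup>2)"
proof -
  let ?P = "{..<n} \<times> {..<n}"
  let ?m = "\<lambda>U p. cube_coord U (fst p) * cube_coord U (snd p)"
  obtain c where c: "\<And>U. f U = (\<Sum>p\<in>?P. c p * ?m U p)"
    using assms by (auto simp: quadratic_def)
  have "pexp (\<lambda>U. (f U)\<^sup>2) = pexp (\<lambda>U. \<Sum>p\<in>?P. \<Sum>q\<in>?P. (c p * c q) * (?m U p * ?m U q))"
    unfolding c power2_eq_square sum_product by (simp add: mult_ac)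
  also have "\<dots> = (\<Sum>p\<in>?P. \<Sum>q\<in>?P. (c p * c q) * pexp (\<lambda>U. ?m U p * ?m U q))"
    by (simp only: pexp_sum pexp_cmult)
  also have "\<dots> = (\<Sum>p\<in>?P. \<Sum>q\<in>?P. c p * Y p q * c q)"
    by (intro sum.cong refl) (auto simp: pexp_monomial4)
  also have "\<dots> \<ge> 0"
    by (rule pseudomoment4_psd[OF pseudomoment])
  finally show ?thesis .
qed

lemma quadratic_cmult: "quadratic f \<Longrightarrow> quadratic (\<lambda>U. a * f U)"
  unfolding quadratic_def
proof (elim exE)
  fix c assume c: "\<forall>U. f U = (\<Sum>p\<in>{..<n} \<times> {..<n}. c p * (cube_coord U (fst p) * cube_coord U (snd p)))"
  show "\<exists>c. \<forall>U. a * f U = (\<Sum>p\<in>{..<n} \<times> {..<n}. c p * (cube_coord U (fst p) * cube_coord U (snd p)))"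
    by (rule exI[of _ "\<lambda>p. a * c p"]) (simp add: c sum_distrib_left mult.assoc)
qed

lemma quadratic_add: "quadratic f \<Longrightarrow> quadratic g \<Longrightarrow> quadratic (\<lambda>U. f U + g U)"
  unfolding quadratic_def
proof (elim exE)
  fix c d
  assume c: "\<forall>U. f U = (\<Sum>p\<in>{..<n} \<times> {..<n}. c p * (cube_coord U (fst p) * cube_coord U (snd p)))"
    and d: "\<forall>U. g U = (\<Sum>p\<in>{..<n} \<times> {..<n}. d p * (cube_coord U (fst p) * cube_coord U (snd p)))"
  show "\<exists>c. \<forall>U. f U + g U = (\<Sum>p\<in>{..<n} \<times> {..<n}. c p * (cube_coord U (fst p) * cube_coord U (snd p)))"
    by (rule exI[of _ "\<lambda>p. c p + d p"]) (simp add: c d distrib_right sum.distrib)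
qed

lemma quadratic_diff: "quadratic f \<Longrightarrow> quadratic g \<Longrightarrow> quadratic (\<lambda>U. f U - g U)"
  using quadratic_add[of f "\<lambda>U. (-1) * g U"] quadratic_cmult[of g "-1"] by simp

lemma quadratic_product:
  "quadratic (\<lambda>U. (\<Sum>i<n. a i * cube_coord U i) * (\<Sum>j<n. b j * cube_coord U j))"
  unfolding quadratic_def
  by (rule exI[of _ "\<lambda>p. a (fst p) * b (snd p)"])
    (simp add: sum_product sum.cartesian_product case_prod_beta mult_ac)

text \<open>Brings a single coordinate into the shape that \<open>quadratic_product\<close>
  expects.\<close>

lemma coord_linear_form: "i < n \<Longrightarrow> cube_coord U i = (\<Sum>k<n. (if k = i then 1 else 0) * cube_coord U k)"
  by (simp add: if_distrib[of "\<lambda>z. z * _"] cong: if_cong)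

lemma quadratic_const: "quadratic (\<lambda>U. a)"
proof -
  have "quadratic (\<lambda>U. a * (cube_coord U 0 * cube_coord U 0))"
    by (subst (1 2) coord_linear_form[OF n_pos]) (intro quadratic_cmult quadratic_product)
  then show ?thesis by (simp add: cube_coord_square)
qed

lemma quadratic_sum: "(\<And>k. k \<in> K \<Longrightarrow> quadratic (f k)) \<Longrightarrow> quadratic (\<lambda>U. \<Sum>k\<in>K. f k U)"
  by (induction K rule: infinite_finite_induct) (auto intro: quadratic_add quadratic_const)

end

text \<open>This is a principal submatrix up to relabelling: a coefficient vector on the small index
  set is extended by zero outside the image of \<open>\<pi>\<close>, so positivity is
  inherited.\<close>

lemma pseudomoment4_reindex:
  assumes Y: "pseudomoment4 N Y" and inj: "inj_on \<pi> {..<n}" and sub: "\<pi> ` {..<n} \<subseteq> {..<N}"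
  shows "pseudomoment4 n (\<lambda>p q. Y (map_prod \<pi> \<pi> p) (map_prod \<pi> \<pi> q))"
proof -
  let ?P = "{..<n} \<times> {..<n}" and ?Q = "{..<N} \<times> {..<N}" and ?m = "map_prod \<pi> \<pi>"
  have lt: "\<pi> i < N" if "i < n" for i using sub that by auto
  have minj: "inj_on ?m ?P" using inj by (simp add: map_prod_inj_on)
  have msub: "?m ` ?P \<subseteq> ?Q" using sub by auto
  have psd: "0 \<le> (\<Sum>p\<in>?P. \<Sum>q\<in>?P. c p * Y (?m p) (?m q) * c q)" for c :: "nat \<times> nat \<Rightarrow> real"
  proof -
    define c' where "c' p = (if p \<in> ?m ` ?P then c (inv_into ?P ?m p) else 0)" for p
    have c': "c' (?m p) = c p" if "p \<in> ?P" for p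
      using that minj by (simp add: c'_def)
    have re: "(\<Sum>p\<in>?Q. c' p * g p) = (\<Sum>p\<in>?P. c p * g (?m p))" for g :: "nat \<times> nat \<Rightarrow> real"
    proof -
      have "(\<Sum>p\<in>?Q. c' p * g p) = (\<Sum>p\<in>?m ` ?P. c' p * g p)"
        by (rule sum.mono_neutral_right[OF _ msub]) (auto simp: c'_def)
      also have "\<dots> = (\<Sum>p\<in>?P. c' (?m p) * g (?m p))"
        by (simp add: sum.reindex[OF minj])
      also have "\<dots> = (\<Sum>p\<in>?P. c p * g (?m p))"
        by (intro sum.cong refl) (simp only: c')
      finally show ?thesis .
    qed
    have "0 \<le> (\<Sum>p\<in>?Q. \<Sum>q\<in>?Q. c' p * Y p q * c' q)"
      by (rule pseudomoment4_psd[OF Y])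
    also have "\<dots> = (\<Sum>p\<in>?Q. c' p * (\<Sum>q\<in>?Q. c' q * Y p q))"
      by (simp only: sum_distrib_left mult_ac)
    also have "\<dots> = (\<Sum>p\<in>?P. \<Sum>q\<in>?P. c p * Y (?m p) (?m q) * c q)"
      unfolding re by (simp only: sum_distrib_left mult_ac)
    finally show ?thesis .
  qed
  have rep: "\<forall>i<n. \<forall>j<n. \<forall>k<n. \<forall>k'<n. Y (?m (i, j)) (?m (k, k)) = Y (?m (i, j)) (?m (k', k'))"
    using pseudomoment4_repeat[OF Y] lt by (simp only: map_prod_simp) blast
  have diag: "\<forall>i<n. Y (?m (i, i)) (?m (i, i)) = 1"
    using pseudomoment4_diag[OF Y] lt by simp
  have perm: "Y (?m (f 0, f 1)) (?m (f 2, f 3)) = Y (?m (f (\<sigma> 0), f (\<sigma> 1))) (?m (f (\<sigma> 2), f (\<sigma> 3)))"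
    if "\<forall>m<4. f m < n" "\<sigma> permutes {..<4}" for f :: "nat \<Rightarrow> nat" and \<sigma>
  proof -
    have "(\<pi> \<circ> f) m < N" if "m < 4" for m
      using \<open>\<forall>m<4. f m < n\<close> lt that by simp
    then have "Y ((\<pi> \<circ> f) 0, (\<pi> \<circ> f) 1) ((\<pi> \<circ> f) 2, (\<pi> \<circ> f) 3)
      = Y ((\<pi> \<circ> f) (\<sigma> 0), (\<pi> \<circ> f) (\<sigma> 1)) ((\<pi> \<circ> f) (\<sigma> 2), (\<pi> \<circ> f) (\<sigma> 3))"
      using that(2) by (rule pseudomoment4_permute[OF Y])
    then show ?thesis by simp
  qed
  show ?thesis
    unfolding pseudomoment4_def by (intro conjI rep diag) (blast intro: psd, blast intro: perm)
qed

section \<open>The degree 4 inequality\<close>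

lemma sum_symmetric_square:
  fixes f :: "nat \<Rightarrow> nat \<Rightarrow> real"
  assumes "\<And>i j. i < n \<Longrightarrow> j < n \<Longrightarrow> f i j = f j i"
  shows "(\<Sum>i<n. \<Sum>j<n. f i j) = (\<Sum>i<n. f i i) + 2 * (\<Sum>i<n. \<Sum>j\<in>{i<..<n}. f i j)"
  using assms
proof (induction n)
  case 0
  then show ?case by simp
next
  case (Suc n)
  have "(\<Sum>j\<in>{i<..<Suc n}. f i j) = f i n + (\<Sum>j\<in>{i<..<n}. f i j)" if "i < n" for i
  proof -
    have "{i<..<Suc n} = insert n {i<..<n}" using that by auto
    then show ?thesis by simp
  qed
  moreover have "(\<Sum>j<n. f n j) = (\<Sum>j<n. f j n)"
    by (intro sum.cong refl Suc.prems) auto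
  moreover have "(\<Sum>i<n. \<Sum>j<n. f i j) = (\<Sum>i<n. f i i) + 2 * (\<Sum>i<n. \<Sum>j\<in>{i<..<n}. f i j)"
    by (intro Suc.IH Suc.prems) auto
  moreover have "{n<..<Suc n} = {}" by auto
  ultimately show ?case
    by (simp add: sum.distrib)
qed

lemma etf_pseudomoment_bound:
  fixes v :: "nat \<Rightarrow> real^7"
  assumes etf: "is_ETF 28 v" and Y: "pseudomoment4 28 Y"
  shows "(\<Sum>i<28. \<Sum>j<28. (v i \<bullet> v j) * Y (i, j) (0, 0)) \<le> 308 / 3"
proof -
  interpret pseudomoment 28 Y by unfold_locales (use Y in auto)
  define y where "y U = (\<Sum>i<28. cube_coord U i *\<^sub>R v i)" for U
  define t where "t U = y U \<bullet> y U" for U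
  define h where "h U i = v i \<bullet> y U" for U i
  define \<delta> where "\<delta> U i = 5 / 4 - cube_coord U i * h U i / 4 - 9 / 200 * (h U i * h U i)" for U i
  define r where "r U j k = cube_coord U j * cube_coord U k - h U j * h U k / 10
    - (v j \<bullet> v k) * (\<delta> U j + \<delta> U k)" for U j k
  have h: "h U i = (\<Sum>k<28. (v i \<bullet> v k) * cube_coord U k)" for U i
    by (simp add: h_def y_def inner_sum_right mult.commute)
  have qhh: "quadratic (\<lambda>U. h U i * h U j)" for i j
    unfolding h by (rule quadratic_product)
  have qxh: "quadratic (\<lambda>U. cube_coord U i * h U j)" if "i < 28" for i j
    unfolding h by (subst coord_linear_form[OF that]) (rule quadratic_product)
  have qxx: "quadratic (\<lambda>U. cube_coord U i * cube_coord U j)" if "i < 28" "j < 28" for i j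
    by (subst coord_linear_form[OF that(1)], subst coord_linear_form[OF that(2)])
      (rule quadratic_product)
  have q\<delta>: "quadratic (\<lambda>U. \<delta> U i)" if "i < 28" for i
    using quadratic_diff[OF quadratic_diff[OF quadratic_const quadratic_cmult[OF qxh[OF that], of "1 / 4"]]
        quadratic_cmult[OF qhh], of "5 / 4" i "9 / 200" i i]
    unfolding \<delta>_def by simp
  have qr: "quadratic (\<lambda>U. r U j k)" if "j < 28" "k < 28" for j k
    using quadratic_diff[OF quadratic_diff[OF qxx[OF that] quadratic_cmult[OF qhh[of j k], of "1 / 10"]]
        quadratic_cmult[OF quadratic_add[OF q\<delta>[OF that(1)] q\<delta>[OF that(2)]], of "v j \<bullet> v k"]]
    unfolding r_def by simp
  have t: "t U = (\<Sum>i<28. \<Sum>j<28. (v i \<bullet> v j) * (cube_coord U i * cube_coord U j))" for U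
    by (simp add: t_def y_def inner_sum_left inner_sum_right mult_ac sum_distrib_left)
      (simp add: inner_commute)
  have qt: "quadratic (\<lambda>U. t U)"
    unfolding t by (intro quadratic_sum quadratic_cmult qxx) auto
  have pt: "pexp t = (\<Sum>i<28. \<Sum>j<28. (v i \<bullet> v j) * Y (i, j) (0, 0))"
    unfolding t[abs_def] pexp_sum pexp_cmult by (intro sum.cong refl) (simp add: pexp_monomial2)
  \<comment> \<open>The negative multiple of the square of \<open>t U\<close> is absorbed into a
    multiple of the square of \<open>t U - 100\<close>, which is again a square of a quadratic; only
    a term linear in \<open>t U\<close> remains.\<close>
  have id: "(\<Sum>j<28. \<Sum>k<28. (r U j k)\<^sup>2) + 3083 / 45000 * (t U - 100)\<^sup>2 + 965600 / 45000 * t U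
      = 1484 + 30830 / 45" for U
    using etf_sum_of_squares[OF etf, of "cube_coord U", OF cube_coord_square]
    unfolding r_def \<delta>_def h_def t_def y_def
    by (simp add: power2_eq_square algebra_simps)
  have "1484 + 30830 / 45 = pexp (\<lambda>U. (\<Sum>j<28. \<Sum>k<28. (r U j k)\<^sup>2)
      + 3083 / 45000 * (t U - 100)\<^sup>2 + 965600 / 45000 * t U)"
    unfolding id by (rule pexp_const[symmetric])
  also have "\<dots> = (\<Sum>j<28. \<Sum>k<28. pexp (\<lambda>U. (r U j k)\<^sup>2))
      + 3083 / 45000 * pexp (\<lambda>U. (t U - 100)\<^sup>2) + 965600 / 45000 * pexp t"
    by (simp only: pexp_add pexp_sum pexp_cmult)
  also have "\<dots> \<ge> 965600 / 45000 * pexp t"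
  proof -
    have "0 \<le> (\<Sum>j<28. \<Sum>k<28. pexp (\<lambda>U. (r U j k)\<^sup>2))"
      by (intro sum_nonneg pexp_square_nonneg qr) auto
    moreover have "0 \<le> pexp (\<lambda>U. (t U - 100)\<^sup>2)"
      by (intro pexp_square_nonneg quadratic_diff qt quadratic_const)
    ultimately show ?thesis by simp
  qed
  \<comment> \<open>The quotient of the two constants is about 101.09, below 308/3.\<close>
  finally show ?thesis unfolding pt by simp
qed

lemma etf_sgn:
  fixes v :: "nat \<Rightarrow> real^7"
  assumes "is_ETF 28 v" "i < 28" "j < 28" "i \<noteq> j"
  shows "sgn (gram v i j) = 3 * gram v i j" "sgn (gram v i j) * sgn (gram v i j) = 1"
proof -
  have "(gram v i j)\<^sup>2 = (1 / 3)\<^sup>2"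
    using etf_inner_sq[OF assms(1-3)] assms(4) by (simp add: gram_def power2_eq_square)
  then have "gram v i j = 1 / 3 \<or> gram v i j = - (1 / 3)"
    by (simp only: power2_eq_iff)
  then show "sgn (gram v i j) = 3 * gram v i j" "sgn (gram v i j) * sgn (gram v i j) = 1"
    by auto
qed

lemma etf_E4_inequality:
  fixes v :: "nat \<Rightarrow> real^7"
  assumes etf: "is_ETF 28 v" and X: "X \<in> E4 N"
    and inj: "inj_on \<pi> {..<28}" and sub: "\<pi> ` {..<28} \<subseteq> {..<N}"
  shows "(\<Sum>i<28. \<Sum>j\<in>{i<..<28}. sgn (gram v i j) * X (\<pi> i) (\<pi> j)) \<le> 112"
proof -
  obtain Y where Y: "pseudomoment4 N Y" and YX: "\<And>i j. i < N \<Longrightarrow> j < N \<Longrightarrow> Y (0, i) (0, j) = X i j"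
    using X by (auto simp: E4_def extends4_def)
  define Y' where "Y' = (\<lambda>p q. Y (map_prod \<pi> \<pi> p) (map_prod \<pi> \<pi> q))"
  have Y': "pseudomoment4 28 Y'"
    unfolding Y'_def using pseudomoment4_reindex[OF Y inj sub] .
  have lt: "\<pi> i < N" if "i < 28" for i using sub that by auto
  then have N: "0 < N" by fastforce
  interpret big: pseudomoment N Y by unfold_locales (use Y N in auto)
  interpret small: pseudomoment 28 Y' by unfold_locales (use Y' in auto)
  have XY: "X (\<pi> i) (\<pi> j) = Y' (i, j) (0, 0)" if "i < 28" "j < 28" for i j
  proof -
    have "X (\<pi> i) (\<pi> j) = big.moment [0, \<pi> i, 0, \<pi> j]"
      using YX lt that by (simp add: big.moment_def)
    also have "\<dots> = big.moment [\<pi> i, \<pi> j, 0, 0]"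
      by (rule big.moment_permute) (use lt that N in auto)
    \<comment> \<open>\<open>X\<close> is read off with index 0 of the large matrix, whereas
      \<open>Y'\<close> only sees indices in the image of \<open>\<pi>\<close>.\<close>
    also have "\<dots> = big.moment [\<pi> i, \<pi> j, \<pi> 0, \<pi> 0]"
      by (rule big.moment_repeat) (use lt that N in auto)
    finally show ?thesis by (simp add: big.moment_def Y'_def)
  qed
  have sym: "Y' (i, j) (0, 0) = Y' (j, i) (0, 0)" if "i < 28" "j < 28" for i j
    using small.moment_permute[of "[i, j, 0, 0]" "[j, i, 0, 0]"] that by (simp add: small.moment_def)
  have diag: "Y' (i, i) (0, 0) = 1" if "i < 28" for i
    using small.moment_square[of i 0] that by (simp add: small.moment_def)
  let ?f = "\<lambda>i j. (v i \<bullet> v j) * Y' (i, j) (0, 0)"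
  have "(\<Sum>i<28. \<Sum>j<28. ?f i j) = (\<Sum>i<28. ?f i i) + 2 * (\<Sum>i<28. \<Sum>j\<in>{i<..<28}. ?f i j)"
    by (rule sum_symmetric_square) (use sym in \<open>simp add: inner_commute\<close>)
  also have "(\<Sum>i<28. ?f i i) = 28"
    by (simp add: etf_unit[OF etf] diag)
  finally have "28 + 2 * (\<Sum>i<28. \<Sum>j\<in>{i<..<28}. ?f i j) \<le> 308 / 3"
    using etf_pseudomoment_bound[OF etf Y'] by simp
  moreover have "(\<Sum>i<28. \<Sum>j\<in>{i<..<28}. sgn (gram v i j) * X (\<pi> i) (\<pi> j))
      = 3 * (\<Sum>i<28. \<Sum>j\<in>{i<..<28}. ?f i j)"
    unfolding sum_distrib_left
    by (intro sum.cong refl) (simp add: etf_sgn(1)[OF etf] XY, simp add: gram_def)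
  \<comment> \<open>The bound is 3 * (308/3 - 28) / 2 = 112.\<close>
  ultimately show ?thesis by simp
qed

section \<open>Triangle inequalities\<close>

lemma sum_unordered_pair:
  fixes g :: "nat \<Rightarrow> nat \<Rightarrow> real"
  assumes "p < N" "q < N" "p \<noteq> q" and sym: "\<And>a b. g a b = g b a"
  shows "(\<Sum>(a, b)\<in>{(a, b). a < b \<and> b < N}. if {a, b} = {p, q} then g a b else 0) = g p q"
proof -
  have fin: "finite {(a, b). a < b \<and> b < N}"
    by (rule finite_subset[of _ "{..<N} \<times> {..<N}"]) auto
  have "(\<Sum>(a, b)\<in>{(a, b). a < b \<and> b < N}. if {a, b} = {p, q} then g a b else 0)
    = (\<Sum>x\<in>{(a, b). a < b \<and> b < N}. if x = (min p q, max p q) then g p q else 0)"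
  proof (intro sum.cong refl, clarify)
    fix a b :: nat assume "a < b"
    then have "{a, b} = {p, q} \<longleftrightarrow> (a, b) = (min p q, max p q)"
      using assms(3) by (cases "p < q") (auto simp: doubleton_eq_iff min_def max_def)
    moreover have "{a, b} = {p, q} \<Longrightarrow> g a b = g p q"
      using sym by (metis doubleton_eq_iff)
    ultimately show "(if {a, b} = {p, q} then g a b else 0)
        = (if (a, b) = (min p q, max p q) then g p q else 0)"
      by presburger
  qed
  also have "\<dots> = g p q"
    using assms(1-3) fin by (simp add: sum.delta min_def max_def)
  finally show ?thesis .
qed

lemma etf_coeff_commute: "etf_coeff Z \<pi> a b = etf_coeff Z \<pi> b a"
  by (simp add: etf_coeff_def insert_commute)

text \<open>By injectivity and the ordering of the indices exactly one summand survives.\<close>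

lemma etf_coeff_image:
  assumes inj: "inj_on \<pi> {..<28}" and ij: "i < j" "j < 28"
  shows "etf_coeff Z \<pi> (\<pi> i) (\<pi> j) = sgn (Z i j)"
proof -
  have eq: "{\<pi> i', \<pi> j'} = {\<pi> i, \<pi> j} \<longleftrightarrow> i' = i \<and> j' = j" if "i' < j'" "j' < 28" for i' j'
    using inj ij that by (auto simp: doubleton_eq_iff inj_on_eq_iff)
  have "etf_coeff Z \<pi> (\<pi> i) (\<pi> j)
    = (\<Sum>i'<28. \<Sum>j'\<in>{i'<..<28}. if j' = j then if i' = i then sgn (Z i j) else 0 else 0)"
    unfolding etf_coeff_def by (intro sum.cong refl) (auto simp: eq)
  also have "\<dots> = (\<Sum>i'<28. if i' = i then sgn (Z i j) else 0)"
    using ij by (intro sum.cong refl) (auto simp: sum.delta)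
  also have "\<dots> = sgn (Z i j)"
    using ij by (simp add: sum.delta)
  finally show ?thesis .
qed

lemma abs_etf_coeff_le_1:
  assumes inj: "inj_on \<pi> {..<28}"
  shows "\<bar>etf_coeff Z \<pi> a b\<bar> \<le> 1"
proof (cases "\<exists>i j. i < j \<and> j < 28 \<and> {\<pi> i, \<pi> j} = {a, b}")
  case True
  then obtain i j where "i < j" "j < 28" "{\<pi> i, \<pi> j} = {a, b}" by blast
  then have "etf_coeff Z \<pi> a b = sgn (Z i j)"
    using etf_coeff_image[OF inj, of i j Z] etf_coeff_commute[of Z \<pi> a b]
    by (auto simp: doubleton_eq_iff)
  then show ?thesis by (simp add: sgn_if)
next
  case False
  then have "etf_coeff Z \<pi> a b = 0"
    unfolding etf_coeff_def by (intro sum.neutral ballI) auto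
  then show ?thesis by simp
qed

text \<open>Only three entries of \<open>g\<close> occur, each with a sign. Equivalently,
  \<open>g / 3\<close> satisfies every triangle inequality.\<close>

lemma tri_coeff_pairing_le_3:
  assumes t: "t \<in> tri_index N" and sym: "\<And>a b. g a b = g b a" and le: "\<And>a b. \<bar>g a b\<bar> \<le> 1"
  shows "(\<Sum>(a, b)\<in>{(a, b). a < b \<and> b < N}. tri_coeff t a b * g a b) \<le> 3"
proof -
  obtain i j k s where ts: "t = (i, j, k, s)" by (cases t) auto
  have lt: "i < N" "j < N" "k < N" "i \<noteq> j" "j \<noteq> k" "i \<noteq> k" and s: "\<And>x. x < N \<Longrightarrow> \<bar>s x\<bar> = 1"
    using t unfolding ts tri_index_def by auto
  let ?P = "{(a, b). a < b \<and> b < N}"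
  have one: "(\<Sum>(a, b)\<in>?P. (if {a, b} = {p, q} then - s p * s q else 0) * g a b) \<le> 1"
    if "p < N" "q < N" "p \<noteq> q" for p q
  proof -
    have "(\<Sum>(a, b)\<in>?P. (if {a, b} = {p, q} then - s p * s q else 0) * g a b)
      = (\<Sum>(a, b)\<in>?P. if {a, b} = {p, q} then - s p * s q * g a b else 0)"
      by (intro sum.cong refl) auto
    also have "\<dots> = - s p * s q * g p q"
      by (rule sum_unordered_pair[OF that]) (metis sym)
    also have "\<dots> \<le> \<bar>- s p * s q * g p q\<bar>" by (rule abs_ge_self)
    also have "\<dots> \<le> 1" using s that le by (simp add: abs_mult)
    finally show ?thesis .
  qed
  have "(\<Sum>(a, b)\<in>?P. tri_coeff t a b * g a b)
    = (\<Sum>(a, b)\<in>?P. (if {a, b} = {i, j} then - s i * s j else 0) * g a b)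
    + (\<Sum>(a, b)\<in>?P. (if {a, b} = {j, k} then - s j * s k else 0) * g a b)
    + (\<Sum>(a, b)\<in>?P. (if {a, b} = {i, k} then - s i * s k else 0) * g a b)"
    unfolding ts by (simp only: tri_coeff.simps distrib_right split_def sum.distrib)
  also have "\<dots> \<le> 3"
    using one[of i j] one[of j k] one[of i k] lt by linarith
  finally show ?thesis .
qed

text \<open>Each of the 28 * 27 / 2 = 378 pairs contributes the square of a sign, and all other
  coefficients vanish.\<close>

lemma etf_coeff_norm_square:
  fixes v :: "nat \<Rightarrow> real^7"
  assumes etf: "is_ETF 28 v" and inj: "inj_on \<pi> {..<28}" and sub: "\<pi> ` {..<28} \<subseteq> {..<N}"
  defines "E \<equiv> etf_coeff (gram v) \<pi>"
  shows "(\<Sum>(a, b)\<in>{(a, b). a < b \<and> b < N}. E a b * E a b) = 378"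
proof -
  let ?P = "{(a, b). a < b \<and> b < N}"
  have "(\<Sum>(a, b)\<in>?P. E a b * E a b) = (\<Sum>(a, b)\<in>?P. \<Sum>i<28. \<Sum>j\<in>{i<..<28}.
      sgn (gram v i j) * (if {a, b} = {\<pi> i, \<pi> j} then E a b else 0))"
  proof (intro sum.cong refl, clarsimp)
    fix a b
    \<comment> \<open>One factor is expanded as a sum over frame pairs; the other is kept and later
      evaluated at the image pair.\<close>
    have "E a b * E a b = etf_coeff (gram v) \<pi> a b * E a b" by (simp add: E_def)
    then show "E a b * E a b = (\<Sum>i<28. \<Sum>j\<in>{i<..<28}.
      sgn (gram v i j) * (if {a, b} = {\<pi> i, \<pi> j} then E a b else 0))"
      unfolding etf_coeff_def sum_distrib_right
      by (simp add: if_distrib[of "\<lambda>z. z * _"] if_distrib[of "\<lambda>z. _ * z"] eq_commute[of "{a, b}"] cong: if_cong)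
  qed
  also have "\<dots> = (\<Sum>i<28. \<Sum>j\<in>{i<..<28}. sgn (gram v i j)
      * (\<Sum>(a, b)\<in>?P. if {a, b} = {\<pi> i, \<pi> j} then E a b else 0))"
    by (simp only: split_def sum_distrib_left sum.swap[of _ "{p. fst p < snd p \<and> snd p < N}"])
  also have "\<dots> = (\<Sum>i<28::nat. \<Sum>j\<in>{i<..<28}. 1)"
  proof (intro sum.cong refl)
    fix i j :: nat assume "i \<in> {..<28}" "j \<in> {i<..<28}"
    then have ij: "i < j" "j < 28" "i < 28" by auto
    have "(\<Sum>(a, b)\<in>?P. if {a, b} = {\<pi> i, \<pi> j} then E a b else 0) = E (\<pi> i) (\<pi> j)"
    proof (rule sum_unordered_pair)
      show "\<pi> i < N" "\<pi> j < N" using sub ij by (auto simp: image_subset_iff)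
      show "\<pi> i \<noteq> \<pi> j" using inj ij by (simp add: inj_on_eq_iff)
    qed (simp only: E_def, rule etf_coeff_commute)
    then show "sgn (gram v i j) * (\<Sum>(a, b)\<in>?P. if {a, b} = {\<pi> i, \<pi> j} then E a b else 0) = 1"
      using ij etf_coeff_image[OF inj ij(1,2)] etf_sgn(2)[OF etf] by (simp add: E_def)
  qed
  also have "\<dots> = 378"
    using sum_symmetric_square[of 28 "\<lambda>_ _. 1"] by simp
  finally show ?thesis .
qed

text \<open>This is weak duality. Pairing the combination with the coefficients of the frame form
  gives 378 on one side and at most \<open>3 * (\<Sum>t\<in>T. c t)\<close> on the other. As every
  triangle inequality has right-hand side 1, the sum of the \<open>c t\<close> is the bound that the
  combination certifies.\<close>

lemma etf_not_triangle_combination: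
  fixes v :: "nat \<Rightarrow> real^7"
  assumes etf: "is_ETF 28 v" and inj: "inj_on \<pi> {..<28}" and sub: "\<pi> ` {..<28} \<subseteq> {..<N}"
    and T: "T \<subseteq> tri_index N" and c: "\<And>t. t \<in> T \<Longrightarrow> 0 \<le> c t"
    and eq: "\<And>a b. a < b \<Longrightarrow> b < N \<Longrightarrow> (\<Sum>t\<in>T. c t * tri_coeff t a b) = etf_coeff (gram v) \<pi> a b"
  shows "126 \<le> (\<Sum>t\<in>T. c t)"
proof -
  let ?P = "{(a, b). a < b \<and> b < N}" and ?E = "etf_coeff (gram v) \<pi>"
  have "378 = (\<Sum>(a, b)\<in>?P. ?E a b * ?E a b)"
    using etf_coeff_norm_square[OF etf inj sub] by simp
  also have "\<dots> = (\<Sum>(a, b)\<in>?P. \<Sum>t\<in>T. c t * (tri_coeff t a b * ?E a b))"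
    by (intro sum.cong refl) (auto simp: eq[symmetric] sum_distrib_right mult.assoc)
  also have "\<dots> = (\<Sum>t\<in>T. c t * (\<Sum>(a, b)\<in>?P. tri_coeff t a b * ?E a b))"
    by (simp only: split_def sum_distrib_left sum.swap[of _ "{p. fst p < snd p \<and> snd p < N}"])
  also have "\<dots> \<le> (\<Sum>t\<in>T. c t * 3)"
    using T c by (intro sum_mono mult_left_mono tri_coeff_pairing_le_3 etf_coeff_commute
        abs_etf_coeff_le_1[OF inj]) auto
  finally show ?thesis by (simp add: sum_distrib_right[symmetric])
qed

theorem theorem5:
  fixes v :: "nat \<Rightarrow> real^7" and Z :: "nat \<Rightarrow> nat \<Rightarrow> real" and N :: nat
  assumes etf: "is_ETF 28 v"
    and Z: "Z = gram v"
    and N: "N \<ge> 28"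
  shows "(\<forall>X \<in> E4 N. \<forall>\<pi>. inj_on \<pi> {..<28} \<and> \<pi> ` {..<28} \<subseteq> {..<N} \<longrightarrow>
           (\<Sum>i<28. \<Sum>j\<in>{i<..<28}. sgn (Z i j) * X (\<pi> i) (\<pi> j)) \<le> 112) \<and>
         (\<forall>\<pi>. inj_on \<pi> {..<28} \<and> \<pi> ` {..<28} \<subseteq> {..<N} \<longrightarrow>
           \<not> (\<exists>T c. finite T \<and> T \<subseteq> tri_index N \<and> (\<forall>t\<in>T. 0 \<le> c t) \<and>
                 (\<forall>a b. a < b \<and> b < N \<longrightarrow>
                    (\<Sum>t\<in>T. c t * tri_coeff t a b) = etf_coeff Z \<pi> a b) \<and>
                 (\<Sum>t\<in>T. c t) \<le> 112))"
proof (intro conjI ballI allI impI notI)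
  fix X and \<pi> :: "nat \<Rightarrow> nat"
  assume "X \<in> E4 N" "inj_on \<pi> {..<28} \<and> \<pi> ` {..<28} \<subseteq> {..<N}"
  then show "(\<Sum>i<28. \<Sum>j\<in>{i<..<28}. sgn (Z i j) * X (\<pi> i) (\<pi> j)) \<le> 112"
    unfolding Z using etf_E4_inequality[OF etf] by blast
next
  fix \<pi> :: "nat \<Rightarrow> nat"
  assume \<pi>: "inj_on \<pi> {..<28} \<and> \<pi> ` {..<28} \<subseteq> {..<N}"
    and "\<exists>T c. finite T \<and> T \<subseteq> tri_index N \<and> (\<forall>t\<in>T. 0 \<le> c t) \<and>
      (\<forall>a b. a < b \<and> b < N \<longrightarrow> (\<Sum>t\<in>T. c t * tri_coeff t a b) = etf_coeff Z \<pi> a b) \<and>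
      (\<Sum>t\<in>T. c t) \<le> 112"
  then obtain T c where "T \<subseteq> tri_index N" "\<forall>t\<in>T. 0 \<le> c t"
      "\<forall>a b. a < b \<and> b < N \<longrightarrow> (\<Sum>t\<in>T. c t * tri_coeff t a b) = etf_coeff Z \<pi> a b"
      "(\<Sum>t\<in>T. c t) \<le> 112"
    by blast
  \<comment> \<open>The combination would certify at most 112, but its weights sum to at least
    126.\<close>
  then show False
    using etf_not_triangle_combination[OF etf, of \<pi> N T c] \<pi> by (auto simp: Z)
qed

end
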